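(* Let $G$ be a finite soluble group. Then the following are equivalent: (a) $G$ is nilpotent; (b) the nilpotency graph of $G$ is complete; (c) the Engel graph of $G$ is complete; (d) the nilpotency graph and the Engel graph of $G$ are equal.
   Context: For elements $x,y$ of a group, $[x,y]=x^{-1}y^{-1}xy$, $[x,{}_1y]=[x,y]$ and $[x,{}_{k+1}y]=[[x,{}_ky],y]$ for $k\ge 1$. Both graphs are simple undirected graphs with vertex set $G$. In the nilpotency graph, distinct $x,y$ are adjacent if and only if $\langle x,y\rangle$ is nilpotent. In the Engel graph, distinct $x,y$ are adjacent if and only if there exists a positive integer $k$ such that $[x,{}_ky]=1$ or $[y,{}_kx]=1$. *)

theory Defs
  imports "HOL-Algebra.Algebra" "Graph_Theory.Graph_Theory"
begin

text \<open>The commutator is \<open>[x, y] = x\<inverse> y\<inverse> x y\<close>, not the convention \<open>x y x\<inverse> y\<inverse>\<close> built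
  into \<^const>\<open>derived\<close>.\<close>

definition commutator :: "('a, 'b) monoid_scheme \<Rightarrow> 'a \<Rightarrow> 'a \<Rightarrow> 'a" where
  "commutator G x y = inv\<^bsub>G\<^esub> x \<otimes>\<^bsub>G\<^esub> inv\<^bsub>G\<^esub> y \<otimes>\<^bsub>G\<^esub> x \<otimes>\<^bsub>G\<^esub> y"

text \<open>\<open>iter_commutator G x k y\<close> is \<open>[x, \<^sub>k y]\<close> for \<open>k \<ge> 1\<close>; the recursion is started one step
  earlier, at \<open>[x, \<^sub>0 y] = x\<close>.\<close>

primrec iter_commutator :: "('a, 'b) monoid_scheme \<Rightarrow> 'a \<Rightarrow> nat \<Rightarrow> 'a \<Rightarrow> 'a" where
  "iter_commutator G x 0 y = x"
| "iter_commutator G x (Suc k) y = commutator G (iter_commutator G x k y) y"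

text \<open>The index is shifted by one: \<open>lower_central G n\<close> is the term usually written \<open>\<gamma>\<^sub>n\<^sub>+\<^sub>1(G)\<close>.\<close>

primrec lower_central :: "('a, 'b) monoid_scheme \<Rightarrow> nat \<Rightarrow> 'a set" where
  "lower_central G 0 = carrier G"
| "lower_central G (Suc n) =
     generate G {commutator G x y | x y. x \<in> lower_central G n \<and> y \<in> carrier G}"

definition nilpotent :: "('a, 'b) monoid_scheme \<Rightarrow> bool" where
  "nilpotent G \<longleftrightarrow> (\<exists>n. lower_central G n = {\<one>\<^bsub>G\<^esub>})"

text \<open>Simple undirected graphs are loop-free symmetric pair digraphs (\<^locale>\<open>pair_graph\<close>): an edge
  \<open>{x, y}\<close> is the pair of arcs \<open>(x, y)\<close>, \<open>(y, x)\<close>, and two graphs are equal iff they have the same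
  vertices and the same edges.\<close>

definition nilpotency_graph :: "('a, 'b) monoid_scheme \<Rightarrow> 'a pair_pre_digraph" where
  "nilpotency_graph G =
     \<lparr> pverts = carrier G,
       parcs = {(x, y). x \<in> carrier G \<and> y \<in> carrier G \<and> x \<noteq> y \<and>
                  nilpotent (subgroup_generated G {x, y})} \<rparr>"

definition engel_graph :: "('a, 'b) monoid_scheme \<Rightarrow> 'a pair_pre_digraph" where
  "engel_graph G =
     \<lparr> pverts = carrier G,
       parcs = {(x, y). x \<in> carrier G \<and> y \<in> carrier G \<and> x \<noteq> y \<and>
                  (\<exists>k\<ge>1. iter_commutator G x k y = \<one>\<^bsub>G\<^esub> \<or> iter_commutator G y k x = \<one>\<^bsub>G\<^esub>)} \<rparr>"

lemma pair_graph_nilpotency_graph: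
  assumes "finite (carrier G)"
  shows "pair_graph (nilpotency_graph G)"
proof -
  have "finite (parcs (nilpotency_graph G))"
    by (rule finite_subset[of _ "carrier G \<times> carrier G"])
      (use assms in \<open>auto simp: nilpotency_graph_def\<close>)
  then show ?thesis
    using assms
    by unfold_locales
      (auto simp: nilpotency_graph_def symmetric_def arcs_ends_def arc_to_ends_def
        insert_commute intro!: symI)
qed

lemma pair_graph_engel_graph:
  assumes "finite (carrier G)"
  shows "pair_graph (engel_graph G)"
proof -
  have "finite (parcs (engel_graph G))"
    by (rule finite_subset[of _ "carrier G \<times> carrier G"])
      (use assms in \<open>auto simp: engel_graph_def\<close>)
  then show ?thesis
    using assms
    by unfold_locales
      (auto simp: engel_graph_def symmetric_def arcs_ends_def arc_to_ends_def intro!: symI)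
qed

end

theory Submission
  imports Defs
begin

text \<open>
  Let \<open>H\<close> be the last term of the upper central series. If \<open>H \<noteq> G\<close>, let \<open>A\<close> be the last term of
  the derived series not contained in \<open>H\<close>, so that \<open>A\<close> is normal and abelian modulo \<open>H\<close>. For
  \<open>a \<in> A\<close> and \<open>y \<in> G\<close> we have \<open>[ya, \<^sub>k y] = [a, \<^sub>k y]\<close>, while modulo \<open>H\<close> commutation with \<open>ya\<close> and
  with \<open>y\<close> agree on \<open>A\<close>; hence either alternative in the Engel condition for the pair \<open>ya, y\<close> yields
  elements of \<open>A - H\<close> commuting with \<open>y\<close> modulo \<open>H\<close>. If instead the two graphs agree, then
  \<open>[y, \<^sub>k a] = 1\<close> for large \<open>k\<close>, because \<open>[y, a, a] \<in> H\<close>; so \<open>a, y\<close> generate a nilpotent subgroup and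
  \<open>[a, \<^sub>k y] = 1\<close>. Climbing up the derived series, and adjoining one element at a time within each
  abelian factor, one finds an element of \<open>A - H\<close> that is central modulo \<open>H\<close>, a contradiction.
\<close>

section \<open>Commutators\<close>

context group
begin

text \<open>With \<open>m_assoc\<close> and \<open>inv_mult_group\<close>, these cancellations in
  right-nested products let the simplifier check commutator identities as equalities of reduced
  words.\<close>

lemma inv_mult_cancel_left:
  assumes "x \<in> carrier G" "y \<in> carrier G"
  shows "inv x \<otimes> (x \<otimes> y) = y" and "x \<otimes> (inv x \<otimes> y) = y"
  using assms by (simp_all add: m_assoc [symmetric])

lemma commutator_closed [simp, intro]:
  assumes "x \<in> carrier G" "y \<in> carrier G"
  shows "commutator G x y \<in> carrier G"
  using assms by (simp add: commutator_def)

lemma commutator_one_left [simp]: "y \<in> carrier G \<Longrightarrow> commutator G \<one> y = \<one>"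
  by (simp add: commutator_def)

lemma commutator_self [simp]: "x \<in> carrier G \<Longrightarrow> commutator G x x = \<one>"
  by (simp add: commutator_def m_assoc inv_mult_cancel_left)

lemma inv_commutator:
  assumes "x \<in> carrier G" "y \<in> carrier G"
  shows "inv (commutator G x y) = commutator G y x"
  using assms by (simp add: commutator_def m_assoc inv_mult_group)

lemma commutator_mult_left:
  assumes "a \<in> carrier G" "b \<in> carrier G" "x \<in> carrier G"
  shows "commutator G (a \<otimes> b) x = inv b \<otimes> commutator G a x \<otimes> b \<otimes> commutator G b x"
  using assms by (simp add: commutator_def m_assoc inv_mult_group inv_mult_cancel_left)

lemma commutator_inv_left:
  assumes "a \<in> carrier G" "x \<in> carrier G"
  shows "commutator G (inv a) x = a \<otimes> inv (commutator G a x) \<otimes> inv a"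
  using assms by (simp add: commutator_def m_assoc inv_mult_group inv_mult_cancel_left)

lemma commutator_conj:
  assumes "a \<in> carrier G" "g \<in> carrier G" "x \<in> carrier G"
  shows "commutator G (g \<otimes> a \<otimes> inv g) x = g \<otimes> commutator G a (inv g \<otimes> x \<otimes> g) \<otimes> inv g"
  using assms by (simp add: commutator_def m_assoc inv_mult_group inv_mult_cancel_left)

lemma commutator_mult_self:
  assumes "a \<in> carrier G" "y \<in> carrier G"
  shows "commutator G (y \<otimes> a) y = commutator G a y"
    and "commutator G y (y \<otimes> a) = commutator G y a"
  using assms by (simp_all add: commutator_def m_assoc inv_mult_group inv_mult_cancel_left)

text \<open>The first commutation already removes the factor \<open>y\<close>. With no commutation
  the sides would be \<open>y \<otimes> a\<close> and \<open>a\<close>, hence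
  \<open>Suc k\<close>.\<close>

lemma iter_commutator_mult_self:
  assumes "a \<in> carrier G" "y \<in> carrier G"
  shows "iter_commutator G (y \<otimes> a) (Suc k) y = iter_commutator G a (Suc k) y"
  using assms by (induction k) (simp_all add: commutator_mult_self)

lemma commutator_in_subgroup:
  assumes "subgroup H G" "x \<in> H" "y \<in> H"
  shows "commutator G x y \<in> H"
  using assms by (simp add: commutator_def subgroup.m_closed subgroup.m_inv_closed)

lemma commutator_in_normal:
  assumes "H \<lhd> G" "x \<in> H" "y \<in> carrier G"
  shows "commutator G x y \<in> H" "commutator G y x \<in> H"
proof -
  interpret H: normal H G by fact
  have "inv x \<otimes> (inv y \<otimes> x \<otimes> y) \<in> H"
    using assms by (simp add: H.inv_op_closed1 H.m_closed H.m_inv_closed)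
  then show 1: "commutator G x y \<in> H"
    using assms by (simp add: commutator_def m_assoc)
  have "x \<in> carrier G"
    using assms by auto
  then show "commutator G y x \<in> H"
    using assms H.m_inv_closed [OF 1] by (simp add: inv_commutator)
qed

lemma commutator_in_derived:
  assumes "subgroup H G" "x \<in> H" "y \<in> H"
  shows "commutator G x y \<in> derived G H"
proof -
  have "commutator G x y = inv x \<otimes> inv y \<otimes> inv (inv x) \<otimes> inv (inv y)"
    using assms by (simp add: commutator_def subgroup.mem_carrier)
  moreover have "inv x \<in> H" "inv y \<in> H"
    using assms by (auto intro: subgroup.m_inv_closed)
  ultimately show ?thesis
    unfolding derived_def by (intro generate.incl) blast
qed

lemma exp_of_derived_is_normal: "(derived G ^^ n) (carrier G) \<lhd> G"
  by (induction n) (simp_all add: normal_self derived_is_normal)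

end

section \<open>Centralizers modulo a normal subgroup\<close>

text \<open>For normal \<open>H\<close> this is the preimage in \<open>G\<close> of the centralizer
  of the image of \<open>S\<close> in the quotient by \<open>H\<close>; the encoding avoids quotient
  groups.\<close>

definition centralizer_mod :: "('a, 'b) monoid_scheme \<Rightarrow> 'a set \<Rightarrow> 'a set \<Rightarrow> 'a set" where
  "centralizer_mod G H S = {g \<in> carrier G. \<forall>s\<in>S. commutator G g s \<in> H}"

context group
begin

lemma centralizer_mod_subgroup:
  assumes "H \<lhd> G" "S \<subseteq> carrier G"
  shows "subgroup (centralizer_mod G H S) G"
proof -
  interpret H: normal H G by fact
  show ?thesis
  proof (rule subgroupI)
    show "centralizer_mod G H S \<subseteq> carrier G"
      by (auto simp: centralizer_mod_def)
    have "\<one> \<in> centralizer_mod G H S"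
      using assms by (auto simp: centralizer_mod_def subset_iff)
    then show "centralizer_mod G H S \<noteq> {}"
      by blast
  next
    fix a assume "a \<in> centralizer_mod G H S"
    then show "inv a \<in> centralizer_mod G H S"
      using assms by (auto simp: centralizer_mod_def subset_iff commutator_inv_left H.inv_op_closed2)
  next
    fix a b assume "a \<in> centralizer_mod G H S" "b \<in> centralizer_mod G H S"
    then show "a \<otimes> b \<in> centralizer_mod G H S"
      using assms by (auto simp: centralizer_mod_def subset_iff commutator_mult_left H.inv_op_closed1)
  qed
qed

lemma commutator_in_normal_commute:
  assumes "H \<lhd> G" "x \<in> carrier G" "y \<in> carrier G" "commutator G x y \<in> H"
  shows "commutator G y x \<in> H"
  using assms normal_imp_subgroup subgroup.m_inv_closed inv_commutator by metis

text \<open>Makes the subgroup property of \<open>centralizer_mod\<close>, which concerns the first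
  argument of a commutator, usable for the second.\<close>

lemma centralizer_mod_singleton_commute:
  assumes "H \<lhd> G" "x \<in> carrier G" "y \<in> carrier G"
  shows "y \<in> centralizer_mod G H {x} \<longleftrightarrow> commutator G x y \<in> H"
  using assms commutator_in_normal_commute [of H x y] commutator_in_normal_commute [of H y x]
  unfolding centralizer_mod_def by blast

lemma centralizer_mod_carrier_normal:
  assumes "H \<lhd> G"
  shows "centralizer_mod G H (carrier G) \<lhd> G"
proof -
  interpret H: normal H G by fact
  show ?thesis
  proof (rule normal_invI)
    show "subgroup (centralizer_mod G H (carrier G)) G"
      using assms by (simp add: centralizer_mod_subgroup)
  next
    fix g a assume "g \<in> carrier G" "a \<in> centralizer_mod G H (carrier G)"
    then show "g \<otimes> a \<otimes> inv g \<in> centralizer_mod G H (carrier G)"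
      by (auto simp: centralizer_mod_def commutator_conj H.inv_op_closed2)
  qed
qed

end

section \<open>Central series\<close>

text \<open>Unlike for \<open>lower_central\<close>, the index is the customary one, that of
  Z_n(G).\<close>

primrec upper_central :: "('a, 'b) monoid_scheme \<Rightarrow> nat \<Rightarrow> 'a set" where
  "upper_central G 0 = {\<one>\<^bsub>G\<^esub>}"
| "upper_central G (Suc n) = centralizer_mod G (upper_central G n) (carrier G)"

context group
begin

lemma upper_central_normal: "upper_central G n \<lhd> G"
  by (induction n) (simp_all add: one_is_normal centralizer_mod_carrier_normal)

lemma upper_central_mono_Suc: "upper_central G n \<subseteq> upper_central G (Suc n)"
  using commutator_in_normal(1) [OF upper_central_normal]
    subgroup.mem_carrier [OF normal_imp_subgroup [OF upper_central_normal]]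
  by (simp add: centralizer_mod_def subset_iff)

text \<open>At an index where the cardinality is greatest, the inclusion into the next term must be
  an equality.\<close>

lemma upper_central_stable:
  assumes "finite (carrier G)"
  obtains n where "upper_central G (Suc n) = upper_central G n"
proof -
  have fin: "finite (upper_central G n)" and "card (upper_central G n) \<le> card (carrier G)" for n
    using assms upper_central_normal [of n] normal_imp_subgroup subgroup.subset
    by (metis finite_subset, metis card_mono)
  then obtain n where "\<And>m. card (upper_central G m) \<le> card (upper_central G n)"
    using ex_has_greatest_nat [of "\<lambda>_. True" 0 "\<lambda>n. card (upper_central G n)" "Suc (card (carrier G))"]
    by (auto simp: less_Suc_eq_le)
  then have "upper_central G n = upper_central G (Suc n)"
    using card_seteq [OF fin upper_central_mono_Suc] by blast
  then show ?thesis
    using that by metis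
qed

text \<open>Each commutation moves down one term of the series, so \<open>n\<close> of them reach
  the trivial term.\<close>

lemma iter_commutator_upper_central:
  assumes "x \<in> upper_central G n" "y \<in> carrier G"
  shows "iter_commutator G x n y = \<one>"
proof -
  have "iter_commutator G x j y \<in> upper_central G (n - j)" if "j \<le> n" for j
    using that
  proof (induction j)
    case (Suc j)
    then have "n - j = Suc (n - Suc j)"
      by simp
    then show ?case
      using Suc assms by (auto simp: centralizer_mod_def)
  qed (use assms in simp)
  from this [of n] show ?thesis
    by simp
qed

section \<open>The lower central series and its comparison with the upper one\<close>

lemma lower_central_subgroup: "subgroup (lower_central G n) G"
proof (induction n)
  case (Suc n)
  then show ?case
    by (auto intro!: generate_is_subgroup dest: subgroup.mem_carrier)
qed (simp add: subgroup_self)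

text \<open>The series run in opposite directions: by induction on \<open>j\<close>, the lower term
  at \<open>j\<close> lies in the upper term at \<open>n - j\<close>.\<close>

lemma nilpotent_if_upper_central:
  assumes "upper_central G n = carrier G"
  shows "nilpotent G"
proof -
  have "lower_central G j \<subseteq> upper_central G (n - j)" if "j \<le> n" for j
    using that
  proof (induction j)
    case (Suc j)
    then have "n - j = Suc (n - Suc j)"
      by simp
    then have "lower_central G j \<subseteq> centralizer_mod G (upper_central G (n - Suc j)) (carrier G)"
      using Suc by simp
    then have "{commutator G x y |x y. x \<in> lower_central G j \<and> y \<in> carrier G}
        \<subseteq> upper_central G (n - Suc j)"
      unfolding centralizer_mod_def by blast
    then show ?case
      by (simp add: generate_subgroup_incl normal_imp_subgroup upper_central_normal)
  qed (use assms in simp)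
  from this [of n] have "lower_central G n = {\<one>}"
    using subgroup.one_closed [OF lower_central_subgroup] by auto
  then show ?thesis
    by (auto simp: nilpotent_def)
qed

lemma iter_commutator_lower_central:
  assumes "x \<in> carrier G" "y \<in> carrier G"
  shows "iter_commutator G x n y \<in> lower_central G n"
  using assms by (induction n) (auto intro!: generate.incl)

section \<open>Passage to subgroups, and Engel conditions from nilpotency\<close>

lemma commutator_consistent:
  assumes "subgroup H G" "x \<in> H" "y \<in> H"
  shows "commutator (G\<lparr>carrier := H\<rparr>) x y = commutator G x y"
  using assms by (simp add: commutator_def m_inv_consistent)

lemma iter_commutator_consistent:
  assumes "subgroup H G" "x \<in> H" "y \<in> H"
  shows "iter_commutator (G\<lparr>carrier := H\<rparr>) x n y = iter_commutator G x n y"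
proof -
  have "iter_commutator (G\<lparr>carrier := H\<rparr>) x n y = iter_commutator G x n y \<and>
      iter_commutator G x n y \<in> H"
    using assms by (induction n) (simp_all add: commutator_consistent commutator_in_subgroup)
  then show ?thesis ..
qed

lemma lower_central_subgroup_subset:
  assumes "subgroup H G"
  shows "lower_central (G\<lparr>carrier := H\<rparr>) n \<subseteq> lower_central G n"
proof (induction n)
  case 0
  then show ?case
    using assms by (simp add: subgroup.subset)
next
  case (Suc n)
  let ?H = "G\<lparr>carrier := H\<rparr>"
  let ?S = "{commutator ?H x y |x y. x \<in> lower_central ?H n \<and> y \<in> H}"
  interpret H: group ?H
    using assms by (rule subgroup_imp_group)
  have lc: "lower_central ?H n \<subseteq> H"
    using subgroup.subset [OF H.lower_central_subgroup] by simp
  have "?S \<subseteq> H"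
    using lc assms by (auto simp: commutator_consistent commutator_in_subgroup subset_iff)
  then have "lower_central ?H (Suc n) = generate G ?S"
    using assms by (simp add: generate_consistent)
  moreover have "?S \<subseteq> {commutator G x y |x y. x \<in> lower_central G n \<and> y \<in> carrier G}"
    using Suc lc assms subgroup.subset [OF assms] by (force simp: commutator_consistent subset_iff)
  ultimately show ?case
    by (simp add: mono_generate)
qed

lemma nilpotent_subgroup:
  assumes "nilpotent G" "subgroup H G"
  shows "nilpotent (G\<lparr>carrier := H\<rparr>)"
proof -
  interpret H: group "G\<lparr>carrier := H\<rparr>"
    using assms by (rule_tac subgroup_imp_group)
  obtain n where "lower_central G n = {\<one>}"
    using assms by (auto simp: nilpotent_def)
  then have "lower_central (G\<lparr>carrier := H\<rparr>) n = {\<one>}"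
    using lower_central_subgroup_subset [OF assms(2), of n]
      subgroup.one_closed [OF H.lower_central_subgroup, of n] by auto
  then show ?thesis
    by (auto simp: nilpotent_def)
qed

lemma nilpotent_imp_engel:
  assumes "nilpotent G" "x \<in> carrier G" "y \<in> carrier G"
  shows "\<exists>k\<ge>1. iter_commutator G x k y = \<one>"
proof -
  obtain n where "lower_central G n = {\<one>}"
    using assms by (auto simp: nilpotent_def)
  \<comment> \<open>One commutation more than necessary, since \<open>n\<close> may be 0 while
    \<open>k \<ge> 1\<close> is demanded.\<close>
  then have "iter_commutator G x (Suc n) y = \<one>"
    using iter_commutator_lower_central [of x y n] assms by simp
  then show ?thesis
    by (metis le_add1 plus_1_eq_Suc)
qed

lemma nilpotent_subgroup_generated_imp_engel:
  assumes "nilpotent (subgroup_generated G {x, y})" "x \<in> carrier G" "y \<in> carrier G"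
  shows "\<exists>k\<ge>1. iter_commutator G x k y = \<one>"
proof -
  \<comment> \<open>The intersection with \<open>carrier G\<close> matches the definition of
    \<open>subgroup_generated\<close>.\<close>
  define H where "H = generate G (carrier G \<inter> {x, y})"
  have "subgroup H G" and "x \<in> H" "y \<in> H"
    using assms by (auto simp: H_def intro: generate_is_subgroup generate.incl)
  moreover have "nilpotent (G\<lparr>carrier := H\<rparr>)"
    using assms by (simp add: H_def subgroup_generated_def)
  ultimately show ?thesis
    using group.nilpotent_imp_engel [OF subgroup_imp_group, of H x y] iter_commutator_consistent
    by simp
qed

section \<open>A nilpotency criterion for finite soluble groups\<close>

text \<open>Each alternative gives a sequence in \<open>F\<close> that ends in \<open>H\<close>;
  take a term outside \<open>H\<close> whose successor lies in \<open>H\<close>. In the second case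
  it commutes modulo \<open>H\<close> with \<open>y \<otimes> a\<close>, and with \<open>a\<close>
  by \<open>FF\<close>, hence with \<open>y\<close>.\<close>

lemma engel_fixed_element:
  assumes H: "H \<lhd> G" and F: "subgroup F G"
    and y: "y \<in> carrier G" and Fy: "\<And>f. f \<in> F \<Longrightarrow> commutator G f y \<in> F"
    and FF: "\<And>f g. f \<in> F \<Longrightarrow> g \<in> F \<Longrightarrow> commutator G f g \<in> H"
    and a: "a \<in> F" "a \<notin> H"
    and k: "k \<ge> 1" "iter_commutator G a k y = \<one> \<or> iter_commutator G y k (y \<otimes> a) = \<one>"
  shows "\<exists>z \<in> F - H. commutator G z y \<in> H"
proof -
  interpret H: normal H G by fact
  interpret F: subgroup F G by fact
  have aG: "a \<in> carrier G"
    using a by simp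
  from k(2) show ?thesis
  proof
    assume "iter_commutator G a k y = \<one>"
    then obtain j where j: "iter_commutator G a j y \<notin> H" "iter_commutator G a (Suc j) y \<in> H"
      using ex_least_nat_less [of "\<lambda>j. iter_commutator G a j y \<in> H" k] a by auto
    have "iter_commutator G a i y \<in> F" for i
      by (induction i) (simp_all add: a Fy)
    with j show ?thesis
      by auto
  next
    assume *: "iter_commutator G y k (y \<otimes> a) = \<one>"
    \<comment> \<open>The sequence starts after one commutation, because \<open>y\<close> itself
      need not lie in \<open>F\<close>.\<close>
    define c where "c j = iter_commutator G y (Suc j) (y \<otimes> a)" for j
    have c0: "c 0 = inv (commutator G a y)"
      using y aG by (simp add: c_def commutator_mult_self inv_commutator)
    have cF: "c j \<in> F" for j
    proof (induction j)
      case 0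
      then show ?case
        using a Fy by (simp add: c0)
    next
      case (Suc j)
      \<comment> \<open>The product rule expands the left argument, so the inverse of
        \<open>c (Suc j)\<close> is treated first.\<close>
      have "commutator G (y \<otimes> a) (c j) = inv a \<otimes> inv (commutator G (c j) y) \<otimes> a \<otimes> inv (commutator G (c j) a)"
        using Suc y aG by (simp add: commutator_mult_left inv_commutator)
      also have "\<dots> \<in> F"
        using Suc a Fy by (simp add: commutator_in_subgroup [OF F])
      finally have "inv (commutator G (y \<otimes> a) (c j)) \<in> F"
        by simp
      then show ?case
        using Suc y aG by (simp add: inv_commutator) (simp add: c_def)
    qed
    show ?thesis
    proof (cases "c 0 \<in> H")
      case True
      then have "commutator G a y \<in> H"
        using y aG H.m_inv_closed unfolding c0 by fastforce
      then show ?thesis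
        using a by blast
    next
      case False
      have "c (k - 1) \<in> H"
        using * k by (simp add: c_def del: iter_commutator.simps)
      with False obtain j where j: "c j \<notin> H" "c (Suc j) \<in> H"
        using ex_least_nat_less [of "\<lambda>j. c j \<in> H" "k - 1"] by auto
      have cG: "c j \<in> carrier G"
        using cF by simp
      have "y \<otimes> a \<in> centralizer_mod G H {c j}"
        using j H y aG cG by (simp add: centralizer_mod_singleton_commute) (simp add: c_def)
      moreover have "a \<in> centralizer_mod G H {c j}"
        using H aG cG FF [OF cF a(1)] by (simp add: centralizer_mod_singleton_commute)
      ultimately have "(y \<otimes> a) \<otimes> inv a \<in> centralizer_mod G H {c j}"
        using centralizer_mod_subgroup [OF H, of "{c j}"] cG
        by (simp add: subgroup.m_closed subgroup.m_inv_closed)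
      then have "commutator G (c j) y \<in> H"
        using y aG cG H by (simp add: m_assoc centralizer_mod_singleton_commute)
      then show ?thesis
        using j cF by blast
    qed
  qed
qed

text \<open>Conjugation by \<open>y\<close> changes an element of \<open>T\<close> only by a
  commutator, which again lies in \<open>T\<close>. Hence conjugates of \<open>f\<close> under
  \<open>y\<close> still centralize \<open>T\<close> modulo \<open>H\<close>, and [f, y] is the
  inverse of \<open>f\<close> times such a conjugate.\<close>

lemma commutator_normalizes_centralizer_mod:
  assumes "H \<lhd> G" "subgroup D G" "derived G D \<subseteq> T" "T \<subseteq> D" "y \<in> D"
    and f: "f \<in> centralizer_mod G H T"
  shows "commutator G f y \<in> centralizer_mod G H T"
proof -
  interpret H: normal H G by fact
  interpret D: subgroup D G by fact
  have TG: "T \<subseteq> carrier G" and yG: "y \<in> carrier G" and fG: "f \<in> carrier G"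
    using assms by (auto simp: centralizer_mod_def)
  interpret C: subgroup "centralizer_mod G H T" G
    using H.normal_axioms TG by (rule centralizer_mod_subgroup)
  have "inv y \<otimes> f \<otimes> inv (inv y) \<in> centralizer_mod G H T"
    unfolding centralizer_mod_def
  proof (intro CollectI conjI ballI)
    fix s assume s: "s \<in> T"
    then have sG: "s \<in> carrier G" and sD: "s \<in> D"
      using assms TG by auto
    have "commutator G (inv y) (inv s) \<in> T"
      by (rule subsetD [OF assms(3) commutator_in_derived [OF assms(2)]])
        (use assms(5) sD in simp_all)
    then have "commutator G f (commutator G (inv y) (inv s)) \<in> H" "commutator G f s \<in> H"
      using f s unfolding centralizer_mod_def by blast+
    then have "commutator G (inv y) (inv s) \<in> centralizer_mod G H {f}" "s \<in> centralizer_mod G H {f}"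
      using H.normal_axioms fG sG yG by (simp_all add: centralizer_mod_singleton_commute)
    then have "commutator G (inv y) (inv s) \<otimes> s \<in> centralizer_mod G H {f}"
      using H.normal_axioms fG by (simp add: centralizer_mod_subgroup subgroup.m_closed)
    moreover have "commutator G (inv y) (inv s) \<otimes> s = y \<otimes> s \<otimes> inv y"
      using yG sG by (simp add: commutator_def m_assoc)
    ultimately have "commutator G f (y \<otimes> s \<otimes> inv y) \<in> H"
      using H.normal_axioms fG sG yG by (simp add: centralizer_mod_singleton_commute)
    then show "commutator G (inv y \<otimes> f \<otimes> inv (inv y)) s \<in> H"
      using fG sG yG H.inv_op_closed1 commutator_conj [of f "inv y" s] by simp
  qed (use fG yG in simp)
  then have "inv f \<otimes> (inv y \<otimes> f \<otimes> inv (inv y)) \<in> centralizer_mod G H T"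
    using f by simp
  then show ?thesis
    using fG yG by (simp add: commutator_def m_assoc)
qed

text \<open>The hypothesis \<open>engel\<close> only concerns pairs for which \<open>a\<close> may lie in a normal subgroup that is
  abelian modulo the hypercentre; in this form it follows from completeness of the Engel graph as
  well as from equality of the graphs.\<close>

lemma nilpotent_if_engel_on_sections:
  assumes fin: "finite (carrier G)" and "solvable G"
    and engel: "\<And>a y n. a \<in> carrier G \<Longrightarrow> y \<in> carrier G \<Longrightarrow>
      commutator G (commutator G y a) a \<in> upper_central G n \<Longrightarrow>
      \<exists>k\<ge>1. iter_commutator G a k y = \<one> \<or> iter_commutator G y k (y \<otimes> a) = \<one>"
  shows "nilpotent G"
proof -
  obtain n where n: "upper_central G (Suc n) = upper_central G n"
    using fin by (rule upper_central_stable)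
  define H where "H = upper_central G n"
  define D where "D i = (derived G ^^ i) (carrier G)" for i
  have H: "H \<lhd> G"
    by (simp add: H_def upper_central_normal)
  interpret H: normal H G by fact
  have D: "D i \<lhd> G" for i
    by (simp add: D_def exp_of_derived_is_normal)
  then have Dsub: "subgroup (D i) G" for i
    by (rule normal_imp_subgroup)
  have D_Suc: "commutator G x y \<in> D (Suc i)" if "x \<in> D i" "y \<in> D i" for x y i
    using commutator_in_derived [OF Dsub that] by (simp add: D_def)
  have D_decr: "D (Suc i) \<subseteq> D i" for i
    using derived_incl [OF order_refl Dsub] by (simp add: D_def)
  obtain m where "D m = {\<one>}"
    using \<open>solvable G\<close> by (auto simp: solvable_iff_trivial_derived_seq D_def)
  then have m: "D m \<subseteq> H"
    by simp
  have "carrier G \<subseteq> H"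
  proof (rule ccontr)
    assume "\<not> carrier G \<subseteq> H"
    then have "\<not> D 0 \<subseteq> H"
      by (simp add: D_def)
    then obtain i where i: "\<not> D i \<subseteq> H" "D (Suc i) \<subseteq> H"
      using ex_least_nat_less [of "\<lambda>i. D i \<subseteq> H" m] m by blast
    have AA: "commutator G x y \<in> H" if "x \<in> D i" "y \<in> D i" for x y
      using D_Suc that i by blast
    have "\<exists>z \<in> D i - H. z \<in> centralizer_mod G H (D 0)"
    \<comment> \<open>Climb from \<open>D i\<close>, which centralizes itself modulo
      \<open>H\<close>, to \<open>D 0\<close>, the whole group.\<close>
    proof (rule inc_induct [of 0 i])
      show "\<exists>z \<in> D i - H. z \<in> centralizer_mod G H (D i)"
        using i(1) AA subgroup.mem_carrier [OF Dsub, of _ i] unfolding centralizer_mod_def by blast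
    next
      fix j assume IH: "\<exists>z \<in> D i - H. z \<in> centralizer_mod G H (D (Suc j))"
      \<comment> \<open>Elements of \<open>D j\<close> are adjoined singly. Keeping
        \<open>D (Suc j)\<close> in the set ensures that it contains the derived subgroup of
        \<open>D j\<close>, as the normalization lemma requires.\<close>
      have "\<exists>z \<in> D i - H. z \<in> centralizer_mod G H (D (Suc j) \<union> S)"
        if "finite S" "S \<subseteq> D j" for S
        using that
      proof (induction S)
        case empty
        then show ?case
          using IH by simp
      next
        case (insert y S)
        define T where "T = D (Suc j) \<union> S"
        define F where "F = D i \<inter> centralizer_mod G H T"
        have T: "derived G (D j) \<subseteq> T" "T \<subseteq> D j"
          using insert D_decr by (auto simp: T_def D_def)
        have y: "y \<in> D j" "y \<in> carrier G"
          using insert subgroup.mem_carrier [OF Dsub] by auto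
        have TG: "T \<subseteq> carrier G"
          using T subgroup.subset [OF Dsub] by blast
        have F: "subgroup F G"
          unfolding F_def using H TG Dsub by (intro subgroups_Inter_pair centralizer_mod_subgroup)
        obtain a where a: "a \<in> F" "a \<notin> H"
          using insert unfolding F_def T_def by auto
        have aG: "a \<in> carrier G"
          using a F subgroup.mem_carrier by metis
        \<comment> \<open>Normality puts [y, a] into \<open>D i\<close>, which is abelian modulo
          \<open>H\<close>.\<close>
        have "commutator G (commutator G y a) a \<in> upper_central G n"
          using a commutator_in_normal [OF D, of a i y] AA y by (auto simp: F_def H_def [symmetric])
        then obtain k where k:
          "k \<ge> 1" "iter_commutator G a k y = \<one> \<or> iter_commutator G y k (y \<otimes> a) = \<one>"
          using engel aG y by blast
        have "\<exists>z \<in> F - H. commutator G z y \<in> H"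
          by (rule engel_fixed_element [OF H F y(2) _ _ a k])
            (simp_all add: F_def AA commutator_in_normal [OF D _ y(2)]
              commutator_normalizes_centralizer_mod [OF H Dsub T y(1)])
        then show ?case
          unfolding F_def T_def by (auto simp: centralizer_mod_def)
      qed
      \<comment> \<open>Taking \<open>S\<close> to be the finite set \<open>D j\<close> absorbs
        \<open>D (Suc j)\<close>.\<close>
      from this [of "D j"] show "\<exists>z \<in> D i - H. z \<in> centralizer_mod G H (D j)"
        using fin subgroup.subset [OF Dsub] finite_subset D_decr by (metis Un_absorb1 order_refl)
    qed simp
    \<comment> \<open>The element found is central modulo \<open>H\<close>, so it lies in the next
      upper central term, which equals \<open>H\<close>.\<close>
    then show False
      using n by (auto simp: D_def H_def)
  qed
  then have "upper_central G n = carrier G"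
    using H.subset by (auto simp: H_def)
  then show ?thesis
    by (rule nilpotent_if_upper_central)
qed

section \<open>The two graph conditions as instances of the criterion\<close>

lemma nilpotent_if_engel_complete:
  assumes "finite (carrier G)" "solvable G"
    and engel: "\<And>x y. x \<in> carrier G \<Longrightarrow> y \<in> carrier G \<Longrightarrow> x \<noteq> y \<Longrightarrow>
      \<exists>k\<ge>1. iter_commutator G x k y = \<one> \<or> iter_commutator G y k x = \<one>"
  shows "nilpotent G"
proof (rule nilpotent_if_engel_on_sections [OF assms(1,2)])
  fix a y assume ay: "a \<in> carrier G" "y \<in> carrier G"
  show "\<exists>k\<ge>1. iter_commutator G a k y = \<one> \<or> iter_commutator G y k (y \<otimes> a) = \<one>"
  \<comment> \<open>The Engel hypothesis is used for the pair \<open>y \<otimes> a\<close>,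
    \<open>y\<close>, which must be distinct; equality means that \<open>a\<close> is
    trivial.\<close>
  proof (cases "y \<otimes> a = y")
    case True
    then have "iter_commutator G a 1 y = \<one>"
      using ay by simp
    then show ?thesis
      by blast
  next
    case False
    then obtain k where k: "k \<ge> 1"
      "iter_commutator G (y \<otimes> a) k y = \<one> \<or> iter_commutator G y k (y \<otimes> a) = \<one>"
      using engel [of "y \<otimes> a" y] ay by auto
    then show ?thesis
      using ay iter_commutator_mult_self [of a y "k - 1"] by auto
  qed
qed

text \<open>The hypothesis reverses the direction of an Engel relation: [y, a, a] in the hypercentre
  kills a long commutator [y, a, ..., a], so \<open>a\<close> and \<open>y\<close> generate a
  nilpotent subgroup, which gives [a, y, ..., y] = 1.\<close>

lemma nilpotent_if_engel_imp_nilpotent: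
  assumes "finite (carrier G)" "solvable G"
    and engel: "\<And>x y k. x \<in> carrier G \<Longrightarrow> y \<in> carrier G \<Longrightarrow> x \<noteq> y \<Longrightarrow> k \<ge> 1 \<Longrightarrow>
      iter_commutator G y k x = \<one> \<Longrightarrow> nilpotent (subgroup_generated G {x, y})"
  shows "nilpotent G"
proof (rule nilpotent_if_engel_on_sections [OF assms(1,2)])
  fix a y n
  assume ay: "a \<in> carrier G" "y \<in> carrier G"
    and n: "commutator G (commutator G y a) a \<in> upper_central G n"
  have "\<exists>k\<ge>1. iter_commutator G a k y = \<one>"
  proof (cases "a = y")
    case True
    then have "iter_commutator G a 1 y = \<one>"
      using ay by simp
    then show ?thesis
      by blast
  next
    case False
    have "iter_commutator G (commutator G (commutator G y a) a) j a = iter_commutator G y (j + 2) a" for j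
      by (induction j) simp_all
    then have "iter_commutator G y (n + 2) a = \<one>"
      using iter_commutator_upper_central [OF n] ay by metis
    then have "nilpotent (subgroup_generated G {a, y})"
      using engel [OF ay False, of "n + 2"] by simp
    then show ?thesis
      using ay by (rule nilpotent_subgroup_generated_imp_engel)
  qed
  then show "\<exists>k\<ge>1. iter_commutator G a k y = \<one> \<or> iter_commutator G y k (y \<otimes> a) = \<one>"
    by blast
qed

end

theorem theorem3p3:
  fixes G :: "('a, 'b) monoid_scheme"
  assumes "group G" and "finite (carrier G)" and "solvable G"
  shows "(nilpotent G \<longleftrightarrow> complete_digraph (order G) (with_proj (nilpotency_graph G))) \<and>
         (nilpotent G \<longleftrightarrow> complete_digraph (order G) (with_proj (engel_graph G))) \<and>
         (nilpotent G \<longleftrightarrow> nilpotency_graph G = engel_graph G)"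
proof -
  interpret group G by fact
  let ?K = "{(x, y). (x, y) \<in> carrier G \<times> carrier G \<and> x \<noteq> y}"
  have complete_nilp: "complete_digraph (order G) (with_proj (nilpotency_graph G)) \<longleftrightarrow>
      parcs (nilpotency_graph G) = ?K"
    and complete_engel: "complete_digraph (order G) (with_proj (engel_graph G)) \<longleftrightarrow>
      parcs (engel_graph G) = ?K"
    using assms by (simp_all add: complete_digraph_pair_def order_def nilpotency_graph_def engel_graph_def)
  \<comment> \<open>With these inclusions, completeness of the nilpotency graph forces both
    completeness of the Engel graph and equality of the graphs.\<close>
  have sub: "parcs (nilpotency_graph G) \<subseteq> parcs (engel_graph G)" "parcs (engel_graph G) \<subseteq> ?K"
    using nilpotent_subgroup_generated_imp_engel by (fastforce simp: nilpotency_graph_def engel_graph_def)+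
  have a_b: "parcs (nilpotency_graph G) = ?K" if "nilpotent G"
    using nilpotent_subgroup [OF that] subgroup_subgroup_generated
    by (auto simp: nilpotency_graph_def subgroup_generated_def)
  have c_a: "nilpotent G" if "parcs (engel_graph G) = ?K"
  proof (rule nilpotent_if_engel_complete [OF assms(2,3)])
    fix x y assume "x \<in> carrier G" "y \<in> carrier G" "x \<noteq> y"
    then have "(x, y) \<in> parcs (engel_graph G)"
      using that by simp
    then show "\<exists>k\<ge>1. iter_commutator G x k y = \<one>\<^bsub>G\<^esub> \<or> iter_commutator G y k x = \<one>\<^bsub>G\<^esub>"
      by (simp add: engel_graph_def)
  qed
  have d_a: "nilpotent G" if "nilpotency_graph G = engel_graph G"
  proof (rule nilpotent_if_engel_imp_nilpotent [OF assms(2,3)])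
    fix x y k
    assume "x \<in> carrier G" "y \<in> carrier G" "x \<noteq> y" "k \<ge> 1" "iter_commutator G y k x = \<one>\<^bsub>G\<^esub>"
    then have "(x, y) \<in> parcs (nilpotency_graph G)"
      unfolding that by (auto simp: engel_graph_def)
    then show "nilpotent (subgroup_generated G {x, y})"
      by (simp add: nilpotency_graph_def)
  qed
  have eq: "nilpotency_graph G = engel_graph G \<longleftrightarrow> parcs (nilpotency_graph G) = parcs (engel_graph G)"
    by (auto simp: nilpotency_graph_def engel_graph_def)
  show ?thesis
    unfolding complete_nilp complete_engel using sub a_b c_a d_a eq by blast
qed

end
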